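(* Let $S$ be a four-element ai-semiring that is not isomorphic to $G_3$. Then for every $n\ge 2$ and all elements $x_1,\dots,x_n,z,t_1,\dots,t_n\in S$, putting $s_i=x_i^2$ $(1\le i\le n)$ and $p=s_1s_2\cdots s_n$, one has $$pz\le p+s_1z+\sum_{i=1}^n t_is_iz .$$
   Context: An additively idempotent semiring (ai-semiring) is an algebra $(S,+,\cdot)$ such that $(S,+)$ is a commutative idempotent semigroup, $(S,\cdot)$ is a semigroup (not necessarily commutative), and $x(y+z)=xy+xz$, $(x+y)z=xz+yz$ hold. Its additive order is $a\le b\iff a+b=b$. $G_3=C_3\cup\{\infty\}$ is the ai-semiring where $C_3$ is the cyclic group of order three and $\infty\notin C_3$; addition is $u+v=u$ if $u=v$ and $u+v=\infty$ if $u\ne v$; multiplication extends that of $C_3$ with $\infty$ absorbing. *)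

theory Defs
  imports Main "HOL-Library.Numeral_Type"
begin

text \<open>The library class \<open>semiring\<close> requires neither a zero nor a unit.\<close>

class ai_semiring = semiring +
  assumes add_idem: "a + a = a"

definition add_le :: "'a::ai_semiring \<Rightarrow> 'a \<Rightarrow> bool"  (infix "\<sqsubseteq>" 50) where
  "a \<sqsubseteq> b \<longleftrightarrow> a + b = b"

definition ai_semiring_iso :: "('a::ai_semiring \<Rightarrow> 'b::ai_semiring) \<Rightarrow> bool" where
  "ai_semiring_iso f \<longleftrightarrow>
     bij f \<and> (\<forall>x y. f (x + y) = f x + f y) \<and> (\<forall>x y. f (x * y) = f x * f y)"

text \<open>
  As there is neither a zero nor a unit, \<open>sum\<close> and \<open>prod_list\<close> are not available.
  For \<open>n \<ge> 1\<close> the following are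
  \<open>(\<dots>(s 1 * s 2) * \<dots>) * s n\<close> and \<open>(\<dots>(u 1 + u 2) + \<dots>) + u n\<close>; the indices start at 1.
\<close>

definition seq_prod :: "(nat \<Rightarrow> 'a::semigroup_mult) \<Rightarrow> nat \<Rightarrow> 'a" where
  "seq_prod s n = foldl (*) (s 1) (map s [2..<Suc n])"

definition seq_sum :: "(nat \<Rightarrow> 'a::semigroup_add) \<Rightarrow> nat \<Rightarrow> 'a" where
  "seq_sum u n = foldl (+) (u 1) (map u [2..<Suc n])"

text \<open>
  The semiring \<open>G\<^sub>3\<close>. The numeral type \<open>3\<close> is the ring of integers modulo 3; its additive
  group serves as the cyclic group of order three, hence the addition on exponents in the
  multiplication.
\<close>

datatype G3 = Elt "3" | Infty

instantiation G3 :: ai_semiring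
begin

definition plus_G3 :: "G3 \<Rightarrow> G3 \<Rightarrow> G3" where
  "u + v = (if u = v then u else Infty)"

fun times_G3 :: "G3 \<Rightarrow> G3 \<Rightarrow> G3" where
  "Elt i * Elt j = Elt (i + j)"
| "Infty * v = Infty"
| "u * Infty = Infty"

instance
proof
  fix a b c :: G3
  show "a + b + c = a + (b + c)" "a + b = b + a" "a + a = a"
    by (auto simp: plus_G3_def)
  show "a * b * c = a * (b * c)"
    by (cases a; cases b; cases c) (auto simp: add.assoc)
  show "(a + b) * c = a * c + b * c" "a * (b + c) = a * b + a * c"
    by (cases a; cases b; cases c; auto simp: plus_G3_def)+
qed

end

end

theory Submission
  imports Defs
begin

text \<open>
  Fix the right-hand side \<open>q\<close> and write \<open>J u\<close> for \<open>u \<sqsubseteq> q\<close>, so that \<open>J (u + v)\<close> holds iff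
  \<open>J u\<close> and \<open>J v\<close> do. The semiring \<open>G\<^sub>3\<close> is recognised among the four-element ones by an element
  \<open>g\<close> with \<open>g\<^sup>4 = g \<noteq> g\<^sup>2\<close>. If there is none and some square \<open>s\<^sub>i\<close> with \<open>i \<ge> 2\<close> is not idempotent,
  then four elements leave so little room that multiplication by \<open>s\<^sub>i\<close> nearly annihilates:
  \<open>p z\<close> is \<open>p\<close> or \<open>t\<^sub>i s\<^sub>i z\<close>. If \<open>s\<^sub>2, \<dots>, s\<^sub>n\<close> are all idempotent, consider the prefixes
  \<open>s\<^sub>1, s\<^sub>1 s\<^sub>2, \<dots>, p\<close>. Whenever two of them agree, the factors between them can be cut out;
  so they may be taken distinct, whence \<open>n \<le> 4\<close>, and for each \<open>n\<close> a finite case analysis remains.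
\<close>

lemma univ_four:
  assumes "CARD('a) = 4" "distinct [a, b, c, d :: 'a]"
  shows "u = a \<or> u = b \<or> u = c \<or> u = d"
proof -
  have "finite (UNIV :: 'a set)"
    using assms(1) by (intro card_ge_0_finite) simp
  then have "{a, b, c, d} = UNIV"
    using assms by (intro card_subset_eq) auto
  then show ?thesis
    by blast
qed

lemma ex_fourth:
  assumes "CARD('a) = 4" "distinct [a, b, c :: 'a]"
  shows "\<exists>d. distinct [a, b, c, d] \<and> (\<forall>u. u = a \<or> u = b \<or> u = c \<or> u = d)"
proof -
  have "finite (UNIV :: 'a set)"
    using assms(1) by (intro card_ge_0_finite) simp
  have "\<exists>d. d \<notin> {a, b, c}"
  proof (rule ccontr)
    assume "\<nexists>d. d \<notin> {a, b, c}"
    then have "UNIV = {a, b, c}"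
      by blast
    then have "CARD('a) = card {a, b, c}"
      by simp
    also have "\<dots> \<le> 3"
      by (simp add: card_insert_if)
    finally show False
      using assms(1) by simp
  qed
  then obtain d where "d \<notin> {a, b, c}"
    by blast
  then have "distinct [a, b, c, d]"
    using assms(2) by auto
  with univ_four[OF assms(1) this] show ?thesis
    by blast
qed

lemma foldl_mult_assoc:
  "foldl (*) (a * b) cs = a * foldl (*) b cs" for a :: "'a::semigroup_mult"
  by (induction cs arbitrary: b) (simp_all add: mult.assoc)

lemma add_le_add_iff: "u + v \<sqsubseteq> q \<longleftrightarrow> u \<sqsubseteq> q \<and> v \<sqsubseteq> q"
  unfolding add_le_def by (metis add.assoc add.commute add_idem)

lemma add_le_refl: "u \<sqsubseteq> u"
  by (simp add: add_le_def add_idem)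

lemma add_le_trans: "u \<sqsubseteq> v \<Longrightarrow> v \<sqsubseteq> w \<Longrightarrow> u \<sqsubseteq> w"
  unfolding add_le_def by (metis add.assoc)

lemma add_le_seq_sum:
  assumes "i \<in> {1..n}"
  shows "u i \<sqsubseteq> seq_sum u n"
  using assms
proof (induction n)
  case (Suc n)
  show ?case
  proof (cases "n = 0")
    case True
    with Suc.prems show ?thesis
      by (auto simp: seq_sum_def add_le_refl)
  next
    case False
    then have sum: "seq_sum u (Suc n) = seq_sum u n + u (Suc n)"
      by (simp add: seq_sum_def upt_Suc_append)
    have "seq_sum u n \<sqsubseteq> seq_sum u (Suc n)" "u (Suc n) \<sqsubseteq> seq_sum u (Suc n)"
      using add_le_refl[of "seq_sum u (Suc n)"] by (auto simp: sum add_le_add_iff)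
    moreover have "i \<in> {1..n} \<or> i = Suc n"
      using Suc.prems by auto
    ultimately show ?thesis
      using Suc.IH by (metis add_le_trans)
  qed
qed simp

section \<open>Recognising \<open>G\<^sub>3\<close>\<close>

text \<open>The powers of \<open>g\<close> form a cyclic group of order three with identity
  \<open>k\<close>. The remaining element \<open>d\<close> is then forced to be the sum of any two
  distinct powers and to be absorbing, like \<open>Infty\<close>.\<close>

lemma ex_iso_G3:
  fixes g :: "'a::ai_semiring"
  assumes card: "CARD('a) = 4" and g4: "g * g * g * g = g" and g2: "g * g \<noteq> g"
  shows "\<exists>f :: 'a \<Rightarrow> G3. ai_semiring_iso f"
proof -
  define h where "h = g * g"
  define k where "k = g * g * g"
  have mult: "g * g = h" "g * h = k" "g * k = g" "h * g = k" "h * h = g" "h * k = h"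
    "k * g = g" "k * h = h" "k * k = k"
    using g4 by (simp_all add: h_def k_def mult.assoc)
  have ne: "distinct [g, h, k]"
    using mult g2 by (metis distinct_length_2_or_more distinct_singleton)
  then obtain d where d: "distinct [g, h, k, d]"
    and U: "\<forall>u. u = g \<or> u = h \<or> u = k \<or> u = d"
    using ex_fourth[OF card ne] by blast
  have cycle: "h + k = g * (g + h)" "k + g = h * (g + h)"
    by (simp_all add: distrib_left mult)
  text \<open>A power of \<open>g\<close> as the sum of two others would yield a cycle in the additive order.\<close>
  have "g + h \<noteq> g" "g + h \<noteq> h" "g + h \<noteq> k"
    using cycle mult ne by (metis add.assoc add.commute add_idem distinct_length_2_or_more)+
  then have gh: "g + h = d"
    using U by blast
  have "k * d = d" "d * k = d"
    using mult by (simp_all flip: gh add: distrib_left distrib_right)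
  \<comment> \<open>If \<open>g * d\<close> were a power of \<open>g\<close>, so would be
    \<open>h * (g * d)\<close>, which equals \<open>k * d = d\<close>.\<close>
  have gd: "g * d = d"
  proof -
    have "h * (g * d) = d"
      using \<open>k * d = d\<close> mult by (simp flip: mult.assoc)
    then show ?thesis
      using U mult d by (metis distinct_length_2_or_more)
  qed
  have dg: "d * g = d"
  proof -
    have "d * g * h = d"
      using \<open>d * k = d\<close> mult by (simp add: mult.assoc)
    then show ?thesis
      using U mult d by (metis distinct_length_2_or_more)
  qed
  have hd: "h * d = d" and dh: "d * h = d"
    using gd dg mult by (metis mult.assoc)+
  have add: "g + h = d" "h + k = d" "k + g = d"
    using gh cycle gd hd by simp_all
  have addd: "g + d = d" "h + d = d" "k + d = d"
    using add add_idem by (metis add.assoc add.commute)+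
  have dd: "d * d = d"
    using gd hd by (metis gh distrib_right add_idem)
  define f where "f u = (if u = g then Elt 1 else if u = h then Elt 2
                         else if u = k then Elt 0 else Infty)" for u
  have f: "f g = Elt 1" "f h = Elt 2" "f k = Elt 0" "f d = Infty"
    using d by (auto simp: f_def)
  have "f (u + v) = f u + f v" for u v
  proof -
    have "h + g = d" "k + h = d" "g + k = d" "d + g = d" "d + h = d" "d + k = d"
      using add addd by (simp_all add: add.commute)
    with spec[OF U, of u] spec[OF U, of v] add addd show ?thesis
      by (elim disjE) (simp_all add: f plus_G3_def add_idem)
  qed
  moreover have "f (u * v) = f u * f v" for u v
    using spec[OF U, of u] spec[OF U, of v] mult gd dg hd dh \<open>k * d = d\<close> \<open>d * k = d\<close> dd
    by (elim disjE) (simp_all add: f)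
  moreover have "inj f"
  proof (rule injI)
    fix u v
    assume "f u = f v"
    with spec[OF U, of u] spec[OF U, of v] show "u = v"
      by (elim disjE) (simp_all add: f)
  qed
  moreover have "surj f"
  proof (rule surjI)
    fix y
    have "{0, 1, 2} = (UNIV :: 3 set)"
      by (intro card_subset_eq) simp_all
    then have "i = 0 \<or> i = 1 \<or> i = 2" for i :: 3
      by blast
    then show "f (case y of Elt i \<Rightarrow> if i = 1 then g else if i = 2 then h else k | Infty \<Rightarrow> d) = y"
      by (cases y) (auto simp: f)
  qed
  ultimately show ?thesis
    unfolding ai_semiring_iso_def bij_def by blast
qed

section \<open>Non-idempotent squares\<close>

text \<open>Otherwise x^4 is none of x, x^2, x^3, so these four powers fill the semiring and end in
  a cycle of length at least two. The sum over the cycle is fixed under multiplication by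
  \<open>x\<close>, yet \<open>x\<close> moves every power.\<close>

lemma powers_stabilize:
  fixes x d :: "'a::ai_semiring"
  assumes "\<And>g::'a. g * g * g * g = g \<Longrightarrow> g * g = g"
    and "\<And>u. u = x \<or> u = x * x \<or> u = x * x * x \<or> u = d"
    and "x * x * (x * x) \<noteq> x * x"
  shows "x * x * x * x * x = x * x * x * x"
  supply [[smt_timeout = 300]]
  by (smt (verit) assms add.commute distrib_left distrib_right mult.assoc)

text \<open>Multiplying x^2 by any power of \<open>x\<close> gives x^3. Hence the first alternative
  holds if \<open>u\<close> and \<open>z\<close> are powers of \<open>x\<close>, the second if
  \<open>u\<close> and \<open>t\<close> are; the other cases involve \<open>d\<close>.\<close>

lemma nonidem_square_last_aux:
  fixes x d u z t :: "'a::ai_semiring"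
  assumes "\<And>g::'a. g * g * g * g = g \<Longrightarrow> g * g = g"
    and "\<And>u. u = x \<or> u = x * x \<or> u = x * x * x \<or> u = d"
    and "x * x * (x * x) \<noteq> x * x" "x * x * x * x = x * x * x"
  shows "u * (x * x) * z = u * (x * x) \<or> u * (x * x) * z = t * (x * x) * z"
  supply [[smt_timeout = 300]]
  by (smt (verit) assms add.commute distrib_left distrib_right mult.assoc)

lemma nonidem_square_middle_aux:
  fixes x d u c z t :: "'a::ai_semiring"
  assumes "\<And>g::'a. g * g * g * g = g \<Longrightarrow> g * g = g"
    and "\<And>u. u = x \<or> u = x * x \<or> u = x * x * x \<or> u = d"
    and "x * x * (x * x) \<noteq> x * x" "x * x * x * x = x * x * x"
  shows "u * (x * x) * c * z = u * (x * x) * c \<or> u * (x * x) * c * z = t * (x * x) * z"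
  supply [[smt_timeout = 300]]
  by (smt (verit) assms add.commute distrib_left distrib_right mult.assoc)

lemma nonidem_square_mult:
  fixes x u z t :: "'a::ai_semiring"
  assumes card: "CARD('a) = 4"
    and H: "\<And>g::'a. g * g * g * g = g \<Longrightarrow> g * g = g"
    and ne: "x * x * (x * x) \<noteq> x * x"
  shows "u * (x * x) * z = u * (x * x) \<or> u * (x * x) * z = t * (x * x) * z"
    and "u * (x * x) * c * z = u * (x * x) * c \<or> u * (x * x) * c * z = t * (x * x) * z"
proof -
  have dist: "distinct [x, x * x, x * x * x]"
    using ne by (auto simp: mult.assoc)
  then obtain d where U: "\<And>u. u = x \<or> u = x * x \<or> u = x * x * x \<or> u = d"
    using ex_fourth[OF card] by blast
  have pow: "x * x * x * x * x = x * x * x * x"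
    using powers_stabilize[OF H U ne] .
  \<comment> \<open>Here the semiring consists of powers of \<open>x\<close>, and the product has
    exponent at least four, from where on the powers are constant.\<close>
  have mono: "u * (x * x) * z = x * x * x * x" if "x * x * x * x \<noteq> x * x * x" for u z
  proof -
    have "distinct [x, x * x, x * x * x, x * x * x * x]"
      using dist that ne H[of x] by (auto simp: mult.assoc)
    then have V: "v = x \<or> v = x * x \<or> v = x * x * x \<or> v = x * x * x * x" for v
      using univ_four[OF card] by blast
    show ?thesis
      using V[of u] V[of z] pow by (auto simp: mult.assoc)
  qed
  show "u * (x * x) * z = u * (x * x) \<or> u * (x * x) * z = t * (x * x) * z"
    using nonidem_square_last_aux[OF H U ne] mono by metis
  show "u * (x * x) * c * z = u * (x * x) * c \<or> u * (x * x) * c * z = t * (x * x) * z"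
    using nonidem_square_middle_aux[OF H U ne] mono by metis
qed

section \<open>Products of idempotents\<close>

text \<open>Two prefixes \<open>a\<close> and \<open>a * e\<close> are too few to describe the
  semiring, so \<open>e\<close>, \<open>z\<close> and \<open>e * z\<close> are used in their
  place.\<close>

lemma idem_mult_one:
  fixes a e z t d :: "'a::ai_semiring"
  assumes "\<And>u v. J (u + v) \<longleftrightarrow> J u \<and> J v"
    and "\<And>u. u = e \<or> u = z \<or> u = e * z \<or> u = d"
    and "e * e = e" "J (a * z)" "J (a * e)" "J (t * e * z)"
  shows "J (a * e * z)"
  supply [[smt_timeout = 300]]
  by (smt (verit) assms distrib_left distrib_right mult.assoc)

lemma idem_mult_two:
  fixes a e f z t u d :: "'a::ai_semiring"
  assumes "\<And>u v. J (u + v) \<longleftrightarrow> J u \<and> J v"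
    and "\<And>u. u = a \<or> u = a * e \<or> u = a * e * f \<or> u = d"
    and "e * e = e" "f * f = f"
    and "J (a * z)" "J (a * e * f)" "J (t * e * z)" "J (u * f * z)"
  shows "J (a * e * f * z)"
  supply [[smt_timeout = 300]]
  by (smt (verit) assms distrib_left distrib_right mult.assoc)

text \<open>The prefixes fill the semiring, so \<open>t\<close> is one of them. For the last two,
  \<open>t * g * z\<close> is already the product in question; \<open>a\<close> and
  \<open>a * e\<close> remain.\<close>

lemma idem_mult_three:
  fixes a e f g z t :: "'a::ai_semiring"
  assumes "\<And>u v. J (u + v) \<longleftrightarrow> J u \<and> J v"
    and "\<And>u. u = a \<or> u = a * e \<or> u = a * e * f \<or> u = a * e * f * g"
    and "e * e = e" "f * f = f" "g * g = g"
    and "J (a * z)" "J (a * e * f * g)" "J (t * g * z)"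
  shows "J (a * e * f * g * z)"
  supply [[smt_timeout = 300]]
  by (smt (verit) assms distrib_left distrib_right mult.assoc)

text \<open>The multiplier \<open>t\<close> is chosen per factor rather than indexed by position, so
  that the hypothesis survives the deletion of factors.\<close>

lemma idem_mult_list:
  fixes a z :: "'a::ai_semiring"
  assumes card: "CARD('a) = 4"
    and J: "\<And>u v. J (u + v) \<longleftrightarrow> J u \<and> J v"
    and az: "J (a * z)"
    and "\<And>e. e \<in> set es \<Longrightarrow> e * e = e \<and> (\<exists>t. J (t * e * z))"
    and "J (foldl (*) a es)"
  shows "J (foldl (*) a es * z)"
  using assms(4,5)
proof (induction es rule: length_induct)
  case (1 es)
  let ?p = "\<lambda>i. foldl (*) a (take i es)"
  show ?case
  proof (cases "inj_on ?p {..length es}")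
    case False
    then obtain i j where ij: "i < j" "j \<le> length es" "?p i = ?p j"
      unfolding inj_on_def by (metis atMost_iff linorder_neqE_nat)
    let ?es = "take i es @ drop j es"
    have fold: "foldl (*) a ?es = foldl (*) a es"
      using ij(3) by (metis append_take_drop_id foldl_append)
    have "length ?es < length es" "set ?es \<subseteq> set es"
      using ij by (auto dest: in_set_takeD in_set_dropD)
    with 1 fold show ?thesis
      by (metis subsetD)
  next
    case True
    \<comment> \<open>The empty prefix, with value \<open>a\<close>, counts too, so four elements
      allow only three factors.\<close>
    then have "Suc (length es) \<le> CARD('a)"
      using card_inj_on_le[of ?p "{..length es}" UNIV] card card_ge_0_finite by fastforce
    then have "length es \<le> 3"
      using card by simp
    then consider "es = []" | e where "es = [e]" | e f where "es = [e, f]"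
      | e f g where "es = [e, f, g]"
      by (auto simp: numeral_3_eq_3 le_Suc_eq length_Suc_conv)
    then show ?thesis
    proof cases
      case 1
      then show ?thesis
        using az by simp
    next
      case (2 e)
      then obtain t where e: "e * e = e" "J (t * e * z)" "J (a * e)"
        using "1.prems" by auto
      show ?thesis
      proof (rule ccontr)
        assume "\<not> ?thesis"
        then have "\<not> J (a * e * z)"
          using 2 by simp
        \<comment> \<open>Any coincidence would turn \<open>a * e * z\<close> into
          \<open>a * e\<close> or \<open>a * z\<close>.\<close>
        then have "distinct [e, z, e * z]"
          using az e by (auto simp: mult.assoc)
        then obtain d where "\<And>u. u = e \<or> u = z \<or> u = e * z \<or> u = d"
          using ex_fourth[OF card] by blast
        from idem_mult_one[OF J this e(1) az e(3,2)] show False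
          using \<open>\<not> J (a * e * z)\<close> by blast
      qed
    next
      case (3 e f)
      then have "\<exists>t. J (t * e * z)" "\<exists>u. J (u * f * z)" and ef: "e * e = e" "f * f = f" "J (a * e * f)"
        using "1.prems" by auto
      then obtain t u where tu: "J (t * e * z)" "J (u * f * z)"
        by blast
      have "distinct [a, a * e, a * e * f]"
        using True 3 by (auto simp: atMost_Suc)
      then obtain d where "\<And>u. u = a \<or> u = a * e \<or> u = a * e * f \<or> u = d"
        using ex_fourth[OF card] by blast
      from idem_mult_two[OF J this ef(1,2) az ef(3) tu] show ?thesis
        using 3 by simp
    next
      case (4 e f g)
      then obtain t where efg: "e * e = e" "f * f = f" "g * g = g" "J (a * e * f * g)" "J (t * g * z)"
        using "1.prems" by auto
      have "distinct [a, a * e, a * e * f, a * e * f * g]"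
        using True 4 by (auto simp: atMost_Suc)
      from idem_mult_three[OF J univ_four[OF card this] efg(1-3) az efg(4-5)] show ?thesis
        using 4 by simp
    qed
  qed
qed

theorem proposition4p1:
  fixes x t s :: "nat \<Rightarrow> 'a::ai_semiring" and z p :: 'a and n :: nat
  assumes "CARD('a) = 4"
    and "\<nexists>f :: 'a \<Rightarrow> G3. ai_semiring_iso f"
    and "n \<ge> 2"
    and "\<And>i. i \<in> {1..n} \<Longrightarrow> s i = x i * x i"
    and "p = seq_prod s n"
  shows "p * z \<sqsubseteq> p + s 1 * z + seq_sum (\<lambda>i. t i * s i * z) n"
proof -
  let ?q = "p + s 1 * z + seq_sum (\<lambda>i. t i * s i * z) n"
  have p: "p \<sqsubseteq> ?q" and az: "s 1 * z \<sqsubseteq> ?q"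
    and sum: "seq_sum (\<lambda>i. t i * s i * z) n \<sqsubseteq> ?q"
    using add_le_refl[of ?q] unfolding add_le_add_iff[of _ _ ?q] by blast+
  have tsz: "t i * s i * z \<sqsubseteq> ?q" if "i \<in> {1..n}" for i
    using add_le_trans[OF add_le_seq_sum[OF that] sum] .
  show ?thesis
  \<comment> \<open>The index 1 is exempt: \<open>s 1\<close> is the initial prefix, and
    \<open>s 1 * z\<close> is itself a summand of the bound.\<close>
  proof (cases "\<forall>i\<in>{2..n}. s i * s i = s i")
    case True
    have "e * e = e \<and> (\<exists>t. t * e * z \<sqsubseteq> ?q)" if "e \<in> set (map s [2..<Suc n])" for e
    proof -
      from that obtain i where "e = s i" "i \<in> {2..n}"
        by auto
      moreover from this have "t i * s i * z \<sqsubseteq> ?q"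
        by (intro tsz) simp
      ultimately show ?thesis
        using True by blast
    qed
    with idem_mult_list[of "\<lambda>u. u \<sqsubseteq> ?q", OF assms(1) add_le_add_iff az] p show ?thesis
      by (simp only: assms(5) seq_prod_def)
  next
    case False
    then obtain i where i: "i \<in> {2..n}" "s i * s i \<noteq> s i"
      by blast
    then have si: "s i = x i * x i"
      using assms(4) by simp
    \<comment> \<open>Since \<open>i\<close> is at least 2, \<open>u\<close> is the nonempty product
      of all factors before \<open>s i\<close>.\<close>
    define u where "u = foldl (*) (s 1) (map s [2..<i])"
    define cs where "cs = map s [Suc i..<Suc n]"
    have "[2..<Suc n] = [2..<i] @ i # [Suc i..<Suc n]"
      using i(1) upt_add_eq_append[of 2 i "Suc n - i"] by (simp add: upt_conv_Cons del: upt_Suc)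
    then have pu: "p = foldl (*) (u * s i) cs"
      by (simp add: assms(5) seq_prod_def u_def cs_def)
    have H: "g * g = g" if "g * g * g * g = g" for g :: 'a
      using ex_iso_G3[OF assms(1) that] assms(2) by blast
    have ne: "x i * x i * (x i * x i) \<noteq> x i * x i"
      using i(2) si by simp
    have "p * z = p \<or> p * z = t i * s i * z"
    \<comment> \<open>Without a unit, an empty product after \<open>s i\<close> needs its own
      case.\<close>
    proof (cases cs)
      case Nil
      then show ?thesis
        using nonidem_square_mult(1)[OF assms(1) H ne] pu si by simp
    next
      case (Cons c cs')
      then have "p = u * s i * foldl (*) c cs'"
        by (simp add: pu foldl_mult_assoc)
      then show ?thesis
        using nonidem_square_mult(2)[OF assms(1) H ne] si by simp
    qed
    then show ?thesis
      using p tsz[of i] i(1) by auto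
  qed
qed

end
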